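(* Let $E$ be a nonzero real Banach space and $S\colon E\rightrightarrows E^*$ be closed, monotone and quasidense. Then $S$ is maximally monotone of type (FPV).
   Context: For a multifunction $S\colon E\rightrightarrows E^*$ with nonempty graph $G(S)$ and domain $D(S)$: closed means $G(S)$ norm-closed in $E\times E^*$; monotone means $\langle s-t,s^*-t^*\rangle\ge0$ for all $(s,s^* ),(t,t^* )\in G(S)$; quasidense means for every $(x,x^* )\in E\times E^*$, $\inf_{(s,s^* )\in G(S)}[\tfrac12\|s-x\|^2+\tfrac12\|s^*-x^*\|^2+\langle s-x,s^*-x^*\rangle]\le0$. A monotone $S$ is of type (FPV) if whenever $U$ is an open convex subset of $E$ with $U\cap D(S)\ne\emptyset$, $(w,w^* )\in U\times E^*$, and $\langle s-w,s^*-w^*\rangle\ge0$ for all $(s,s^* )\in G(S)$ with $s\in U$, then $(w,w^* )\in G(S)$. *)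

theory Defs
  imports "HOL-Analysis.Analysis"
begin

text \<open>A multifunction S from E to its dual E* is represented by its graph
  G(S), a subset of E times E*, where E* is the space of bounded linear
  functionals on E (type of continuous linear maps into the reals).
  The pairing of s in E and s* in E* is the application of s* to s.\<close>

type_synonym 'a graph = "('a \<times> ('a \<Rightarrow>\<^sub>L real)) set"

definition mm_dom :: "'a::real_normed_vector graph \<Rightarrow> 'a set" where
  "mm_dom G = fst ` G"

definition mm_closed :: "'a::real_normed_vector graph \<Rightarrow> bool" where
  "mm_closed G \<longleftrightarrow> closed G"

definition mm_monotone :: "'a::real_normed_vector graph \<Rightarrow> bool" where
  "mm_monotone G \<longleftrightarrow>
     (\<forall>(s, s') \<in> G. \<forall>(t, t') \<in> G. blinfun_apply (s' - t') (s - t) \<ge> 0)"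

definition mm_quasidense :: "'a::real_normed_vector graph \<Rightarrow> bool" where
  "mm_quasidense G \<longleftrightarrow>
     (\<forall>x x'. (INF p \<in> G. (1/2) * (norm (fst p - x))\<^sup>2 + (1/2) * (norm (snd p - x'))\<^sup>2
                 + blinfun_apply (snd p - x') (fst p - x)) \<le> 0)"

definition mm_maximal_monotone :: "'a::real_normed_vector graph \<Rightarrow> bool" where
  "mm_maximal_monotone G \<longleftrightarrow>
     mm_monotone G \<and> (\<forall>T. mm_monotone T \<and> G \<subseteq> T \<longrightarrow> T = G)"

definition mm_type_FPV :: "'a::real_normed_vector graph \<Rightarrow> bool" where
  "mm_type_FPV G \<longleftrightarrow>
     (\<forall>U w w'. open U \<and> convex U \<and> U \<inter> mm_dom G \<noteq> {} \<and> w \<in> U \<and>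
        (\<forall>(s, s') \<in> G. s \<in> U \<longrightarrow> blinfun_apply (s' - w') (s - w) \<ge> 0)
        \<longrightarrow> (w, w') \<in> G)"

end

theory Submission
  imports Defs
begin

text \<open>Quasidensity is stable under rescaling the norm by any \<open>l > 0\<close>.  Indeed, if the Fitzpatrick
  function of \<open>G\<close> plus half the rescaled square norm were bounded below by a positive constant, a
  linear functional squeezed in between (Hahn-Banach) would contradict quasidensity for the
  original norm; and a point where the sum is small is close to a point of \<open>G\<close>, again by
  quasidensity.

  For type (FPV), apply the rescaled condition at \<open>(z, w')\<close>.  As \<open>l\<close> grows, the resulting
  \<open>(s, s') \<in> G\<close> has \<open>s\<close> no farther from \<open>z\<close> than the domain is, up to a small error.  Hence \<open>s\<close> stays
  in \<open>U\<close> if \<open>z\<close> is close enough to the domain.  In short steps from a point of the domain in \<open>U\<close> to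
  \<open>w\<close> this shows that the whole segment lies in the closure of the domain.  At \<open>z = w\<close> the local
  monotonicity hypothesis forces \<open>(s, s')\<close> to converge to \<open>(w, w')\<close>.\<close>

section \<open>Linear minorants of convex functions\<close>

text \<open>Up to adding larger values, the \<open>S x\<close> are the vertical slices of a convex
  set, and the infimum is its lower boundary. Since 0 is the midpoint of \<open>x\<close> and
  \<open>- x\<close>, the sign condition at 0 bounds every slice from below.\<close>

lemma Inf_of_convex_family:
  fixes S :: "'a::real_vector \<Rightarrow> real set"
  assumes ne: "\<And>x. S x \<noteq> {}" and pos: "\<And>r. r \<in> S 0 \<Longrightarrow> 0 \<le> r"
    and cv: "\<And>x y r s t. r \<in> S x \<Longrightarrow> s \<in> S y \<Longrightarrow> 0 < t \<Longrightarrow> t < 1 \<Longrightarrow>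
      \<exists>q \<in> S ((1 - t) *\<^sub>R x + t *\<^sub>R y). q \<le> (1 - t) * r + t * s"
  shows bdd_below_convex_family: "bdd_below (S x)"
    and convex_on_Inf_family: "convex_on UNIV (\<lambda>x. Inf (S x))"
    and Inf_family_nonneg: "0 \<le> Inf (S 0)"
proof -
  have bdd: "bdd_below (S x)" for x
  proof -
    obtain s where s: "s \<in> S (- x)" using ne by blast
    have "- s \<le> r" if r: "r \<in> S x" for r
    proof -
      from cv[OF r s, of "1/2"] obtain q where "q \<in> S 0" "q \<le> (1 - 1/2) * r + 1/2 * s"
        by auto
      with pos[of q] show ?thesis by simp
    qed
    then show ?thesis by (meson bdd_below.I)
  qed
  then show "bdd_below (S x)" .
  show "0 \<le> Inf (S 0)" using ne pos by (simp add: cInf_greatest)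
  show "convex_on UNIV (\<lambda>x. Inf (S x))"
  proof (rule convex_onI)
    fix t :: real and x y :: 'a assume t: "0 < t" "t < 1"
    let ?z = "(1 - t) *\<^sub>R x + t *\<^sub>R y"
    show "Inf (S ?z) \<le> (1 - t) * Inf (S x) + t * Inf (S y)"
    proof (rule field_le_epsilon)
      fix e :: real assume "0 < e"
      obtain r where r: "r \<in> S x" "r < Inf (S x) + e"
        using cInf_lessD[OF ne, of x "Inf (S x) + e"] \<open>0 < e\<close> by auto
      obtain s where s: "s \<in> S y" "s < Inf (S y) + e"
        using cInf_lessD[OF ne, of y "Inf (S y) + e"] \<open>0 < e\<close> by auto
      obtain q where q: "q \<in> S ?z" "q \<le> (1 - t) * r + t * s"
        using cv[OF r(1) s(1) t] by blast
      have "Inf (S ?z) \<le> q" using q bdd by (simp add: cInf_lower)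
      also have "q \<le> (1 - t) * (Inf (S x) + e) + t * (Inf (S y) + e)"
        using q(2) mult_left_mono[of r "Inf (S x) + e" "1 - t"] mult_left_mono[of s "Inf (S y) + e" t] r s t
        by linarith
      finally show "Inf (S ?z) \<le> (1 - t) * Inf (S x) + t * Inf (S y) + e"
        by (simp add: algebra_simps)
    qed
  qed simp
qed

text \<open>Tilting \<open>f\<close> by its least slope \<open>c y\<close> and minimising along the
  ray in direction \<open>y\<close> keeps it convex, below \<open>f\<close> and nonnegative at 0.
  Minimality returns \<open>f\<close> itself, so from every point \<open>f\<close> grows along
  \<open>y\<close> at rate at least \<open>c y\<close>; opposite directions then force
  additivity.\<close>

lemma minimal_convex_imp_linear:
  fixes f :: "'a::real_vector \<Rightarrow> real"
  assumes cf: "convex_on UNIV f" and f0: "0 \<le> f 0"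
    and minimal: "\<And>g. convex_on UNIV g \<Longrightarrow> 0 \<le> g 0 \<Longrightarrow> g \<le> f \<Longrightarrow> g = f"
  shows "linear f"
proof -
  have cvx: "f ((1 - t) *\<^sub>R x + t *\<^sub>R y) \<le> (1 - t) * f x + t * f y" if "0 \<le> t" "t \<le> 1" for t x y
    using convex_onD[OF cf that] by simp
  have "(\<lambda>x. f x - f 0) = f"
  proof (rule minimal)
    show "convex_on UNIV (\<lambda>x. f x - f 0)"
      using cvx by (intro convex_onI) (auto simp: algebra_simps)
  qed (use f0 in \<open>auto simp: le_fun_def\<close>)
  then have f00: "f 0 = 0" by (metis diff_self)
  define c where "c y = Inf ((\<lambda>t. f (t *\<^sub>R y) / t) ` {0<..})" for y
  \<comment> \<open>0 is a convex combination of \<open>t *\<^sub>R y\<close> and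
    \<open>- (u *\<^sub>R y)\<close>, so the quotients on one ray bound those on the opposite ray,
    and \<open>c y\<close> is a genuine infimum.\<close>
  have opp: "- f (- (u *\<^sub>R y)) / u \<le> f (t *\<^sub>R y) / t" if "t > 0" "u > 0" for t u y
  proof -
    define a where "a = t / (t + u)"
    have a: "0 \<le> a" "a \<le> 1" "1 - a = u / (t + u)" using that by (auto simp: a_def field_simps)
    have "(1 - a) *\<^sub>R (t *\<^sub>R y) + a *\<^sub>R (- (u *\<^sub>R y)) = 0"
      by (simp add: a(3)) (simp add: a_def mult.commute)
    with cvx[OF a(1,2), of "t *\<^sub>R y" "- (u *\<^sub>R y)"] f00
    have "0 \<le> u / (t + u) * f (t *\<^sub>R y) + t / (t + u) * f (- (u *\<^sub>R y))"
      by (simp only: a(3)) (simp add: a_def)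
    also have "\<dots> = (u * f (t *\<^sub>R y) + t * f (- (u *\<^sub>R y))) / (t + u)" by (simp add: add_divide_distrib)
    finally have "0 \<le> u * f (t *\<^sub>R y) + t * f (- (u *\<^sub>R y))" using that by (simp add: zero_le_divide_iff)
    then show ?thesis using that by (simp add: field_simps)
  qed
  have bdd: "bdd_below ((\<lambda>t. f (t *\<^sub>R y) / t) ` {0<..})" for y
    using opp[of _ 1 y] by (intro bdd_belowI2[of _ "- f (- y)"]) auto
  have c_le: "t * c y \<le> f (t *\<^sub>R y)" if "t \<ge> 0" for t y
  proof (cases "t = 0")
    case False
    then have "c y \<le> f (t *\<^sub>R y) / t" unfolding c_def using that bdd
      by (intro cInf_lower) auto
    with False that show ?thesis by (simp add: field_simps)
  qed (simp add: f00)
  have c_ge: "- f (- (u *\<^sub>R y)) / u \<le> c y" if "u > 0" for u y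
    unfolding c_def using opp that by (intro cInf_greatest) auto
  have c_opp: "- c y \<le> c (- y)" for y
  proof -
    have "- c y \<le> f (u *\<^sub>R (- y)) / u" if "u > 0" for u
      using c_ge[OF that, of y] by simp
    then show ?thesis unfolding c_def[of "- y"] by (intro cInf_greatest) auto
  qed
  have slope: "f x \<le> f (x + t *\<^sub>R y) - t * c y" if "t \<ge> 0" for x y t
  proof -
    define S where "S x = (\<lambda>t. f (x + t *\<^sub>R y) - t * c y) ` {0..}" for x
    have ne: "S x \<noteq> {}" for x by (simp add: S_def)
    have pos: "0 \<le> r" if "r \<in> S 0" for r using that c_le by (auto simp: S_def)
    have cv: "\<exists>q \<in> S ((1 - t) *\<^sub>R x + t *\<^sub>R z). q \<le> (1 - t) * r + t * s"
      if rs: "r \<in> S x" "s \<in> S z" and t: "0 < t" "t < 1" for x z r s t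
    proof -
      obtain a b where ab: "a \<ge> 0" "b \<ge> 0" "r = f (x + a *\<^sub>R y) - a * c y" "s = f (z + b *\<^sub>R y) - b * c y"
        using rs by (auto simp: S_def)
      define d where "d = (1 - t) * a + t * b"
      have "f ((1 - t) *\<^sub>R x + t *\<^sub>R z + d *\<^sub>R y) - d * c y \<in> S ((1 - t) *\<^sub>R x + t *\<^sub>R z)"
        using ab t by (auto simp: S_def d_def)
      moreover have "(1 - t) *\<^sub>R x + t *\<^sub>R z + d *\<^sub>R y = (1 - t) *\<^sub>R (x + a *\<^sub>R y) + t *\<^sub>R (z + b *\<^sub>R y)"
        by (simp add: d_def algebra_simps)
      then have "f ((1 - t) *\<^sub>R x + t *\<^sub>R z + d *\<^sub>R y) \<le> (1 - t) * f (x + a *\<^sub>R y) + t * f (z + b *\<^sub>R y)"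
        using cvx[of t "x + a *\<^sub>R y" "z + b *\<^sub>R y"] t by simp
      then have "f ((1 - t) *\<^sub>R x + t *\<^sub>R z + d *\<^sub>R y) - d * c y \<le> (1 - t) * r + t * s"
        unfolding ab d_def by (simp add: left_diff_distrib right_diff_distrib distrib_right mult.assoc)
      ultimately show ?thesis by blast
    qed
    have low: "Inf (S x) \<le> f (x + t *\<^sub>R y) - t * c y" if "t \<ge> 0" for x t
      using bdd_below_convex_family[OF ne pos cv] that by (intro cInf_lower) (auto simp: S_def)
    have "(\<lambda>x. Inf (S x)) = f"
      using convex_on_Inf_family[OF ne pos cv] Inf_family_nonneg[OF ne pos cv] low[of 0]
      by (intro minimal) (auto simp: le_fun_def)
    then show ?thesis using low[OF that, of x] by metis
  qed
  have f_neg: "f (- (t *\<^sub>R y)) = - (t * c y)" if "t \<ge> 0" for t y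
  proof (rule antisym)
    show "f (- (t *\<^sub>R y)) \<le> - (t * c y)" using slope[OF that, of "- (t *\<^sub>R y)" y] f00 by simp
    show "- (t * c y) \<le> f (- (t *\<^sub>R y))"
      using c_le[OF that, of "- y"] mult_left_mono[OF c_opp[of y] that] by simp
  qed
  have fc: "f y = c y" for y
    using f_neg[of 1 "- y"] c_le[of 1 y] c_opp[of y] c_opp[of "- y"] by simp
  have hom: "f (t *\<^sub>R y) = t * f y" for t y
  proof (cases "t \<ge> 0")
    case True
    then show ?thesis using f_neg[OF True, of "- y"] f_neg[of 1 y] fc[of y] fc[of "- y"] by simp
  next
    case False
    then show ?thesis using f_neg[of "- t" y] fc[of y] by simp
  qed
  have add: "f (x + y) = f x + f y" for x y
    using slope[of 1 x y] slope[of 1 "x + y" "- y"] fc[of y] fc[of "- y"] hom[of "-1" y] by simp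
  show ?thesis using add hom by (intro linearI) auto
qed

text \<open>Hahn-Banach by Zorn's lemma: the convex functions below \<open>F\<close> that are
  nonnegative at 0 are closed under infima of nonempty chains, and a minimal one is linear.\<close>

lemma convex_linear_minorant:
  fixes F :: "'a::real_vector \<Rightarrow> real"
  assumes cF: "convex_on UNIV F" and F0: "0 \<le> F 0"
  obtains L where "linear L" "\<And>x. L x \<le> F x"
proof -
  define A where "A = {f. convex_on UNIV f \<and> 0 \<le> f 0 \<and> f \<le> F}"
  have "\<exists>m\<in>A. \<forall>a\<in>A. a \<le> m \<longrightarrow> a = m"
  proof (rule predicate_Zorn)
    show "partial_order_on A (relation_of (\<lambda>x y. y \<le> x) A)"
      by (rule partial_order_on_relation_ofI) auto
    fix C assume C: "C \<in> Chains (relation_of (\<lambda>x y. y \<le> x) A)"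
    have CA: "C \<subseteq> A" using C by (rule Chains_relation_of)
    have tot: "f \<le> g \<or> g \<le> f" if "f \<in> C" "g \<in> C" for f g
      using C that by (auto simp: Chains_def relation_of_def)
    show "\<exists>u\<in>A. \<forall>a\<in>C. u \<le> a"
    proof (cases "C = {}")
      case True
      then show ?thesis using cF F0 by (auto simp: A_def intro!: exI[of _ F])
    next
      case False
      define S where "S x = (\<lambda>f. f x) ` C" for x
      have ne: "S x \<noteq> {}" for x using False by (simp add: S_def)
      have pos: "0 \<le> r" if "r \<in> S 0" for r using that CA by (auto simp: S_def A_def)
      have cv: "\<exists>q \<in> S ((1 - t) *\<^sub>R x + t *\<^sub>R y). q \<le> (1 - t) * r + t * s"
        if rs: "r \<in> S x" "s \<in> S y" and t: "0 < t" "t < 1" for x y r s t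
      proof -
        obtain f g where fg: "f \<in> C" "g \<in> C" "r = f x" "s = g y" using rs by (auto simp: S_def)
        \<comment> \<open>In a chain the smaller of \<open>f\<close> and \<open>g\<close> lies below
          both, so its own convexity settles the inequality.\<close>
        obtain h where h: "h \<in> C" "h \<le> f" "h \<le> g" using tot[OF fg(1,2)] fg by blast
        have "h ((1 - t) *\<^sub>R x + t *\<^sub>R y) \<le> (1 - t) * h x + t * h y"
          using h CA t convex_onD[of UNIV h t x y] by (auto simp: A_def)
        also have "\<dots> \<le> (1 - t) * r + t * s"
          using h t fg by (intro add_mono mult_left_mono) (auto simp: le_fun_def)
        finally show ?thesis using h by (auto simp: S_def)
      qed
      have low: "Inf (S x) \<le> f x" if "f \<in> C" for f x
        using bdd_below_convex_family[OF ne pos cv] that by (intro cInf_lower) (auto simp: S_def)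
      obtain f where "f \<in> C" using False by blast
      then have "Inf (S x) \<le> F x" for x
        using low[of f x] CA order_trans by (auto simp: A_def le_fun_def) blast
      then have "(\<lambda>x. Inf (S x)) \<in> A"
        using convex_on_Inf_family[OF ne pos cv] Inf_family_nonneg[OF ne pos cv]
        by (auto simp: A_def le_fun_def)
      then show ?thesis using low by (intro bexI[of _ "\<lambda>x. Inf (S x)"]) (auto simp: le_fun_def)
    qed
  qed
  then obtain m where m: "m \<in> A" "\<And>a. a \<in> A \<Longrightarrow> a \<le> m \<Longrightarrow> a = m" by blast
  have "linear m"
  proof (rule minimal_convex_imp_linear)
    fix g assume "convex_on UNIV g" "0 \<le> g 0" "g \<le> m"
    with m show "g = m" by (auto simp: A_def)
  qed (use m in \<open>auto simp: A_def\<close>)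
  then show ?thesis using m(1) that by (auto simp: A_def le_fun_def)
qed


section \<open>Estimates for square norms and functionals\<close>

lemma norm_convex_combination_square_le:
  fixes u v :: "'a::real_normed_vector"
  assumes "0 \<le> t" "t \<le> 1"
  shows "(norm ((1 - t) *\<^sub>R u + t *\<^sub>R v))\<^sup>2 \<le> (1 - t) * (norm u)\<^sup>2 + t * (norm v)\<^sup>2"
proof -
  have "norm ((1 - t) *\<^sub>R u + t *\<^sub>R v) \<le> (1 - t) * norm u + t * norm v"
    using norm_triangle_ineq[of "(1 - t) *\<^sub>R u" "t *\<^sub>R v"] assms by simp
  then have "(norm ((1 - t) *\<^sub>R u + t *\<^sub>R v))\<^sup>2 \<le> ((1 - t) * norm u + t * norm v)\<^sup>2"
    by (intro power_mono) auto
  also have "\<dots> = (1 - t) * (norm u)\<^sup>2 + t * (norm v)\<^sup>2 - t * (1 - t) * (norm u - norm v)\<^sup>2"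
    by (simp add: power2_eq_square algebra_simps)
  also have "\<dots> \<le> (1 - t) * (norm u)\<^sup>2 + t * (norm v)\<^sup>2" using assms by simp
  finally show ?thesis .
qed

lemma mult_le_weighted_squares:
  fixes a b l :: real
  assumes "l > 0"
  shows "a * b \<le> l / 2 * a\<^sup>2 + b\<^sup>2 / (2 * l)"
proof -
  have "0 \<le> (l * a - b)\<^sup>2 / (2 * l)" using assms by simp
  also have "\<dots> = l / 2 * a\<^sup>2 + b\<^sup>2 / (2 * l) - a * b"
    using assms by (simp add: field_simps power2_eq_square)
  finally show ?thesis by simp
qed

lemma abs_blinfun_le:
  fixes f :: "'a::real_normed_vector \<Rightarrow>\<^sub>L real"
  shows "\<bar>blinfun_apply f x\<bar> \<le> norm x * norm f"
  using norm_blinfun[of f x] by (simp add: mult.commute)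

lemma abs_blinfun_le_weighted_squares:
  fixes f :: "'a::real_normed_vector \<Rightarrow>\<^sub>L real"
  assumes "l > 0"
  shows "\<bar>blinfun_apply f x\<bar> \<le> l / 2 * (norm x)\<^sup>2 + (norm f)\<^sup>2 / (2 * l)"
  using abs_blinfun_le[of f x] mult_le_weighted_squares[OF assms, of "norm x" "norm f"] by linarith

text \<open>The convex conjugate of \<open>c / 2\<close> times the square norm is the dual square
  norm divided by \<open>2 * c\<close>. It is only approached, since \<open>f\<close> need not
  attain its norm.\<close>

lemma blinfun_half_square_conjugate:
  fixes f :: "'a::real_normed_vector \<Rightarrow>\<^sub>L real"
  assumes "c > 0" "d > 0"
  obtains y where "blinfun_apply f y - c / 2 * (norm y)\<^sup>2 > (norm f)\<^sup>2 / (2 * c) - d"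
proof (cases "f = 0")
  case True
  then show ?thesis using that[of 0] assms by simp
next
  case False
  define n where "n = norm f"
  have n: "n > 0" using False by (simp add: n_def)
  \<comment> \<open>Replacing \<open>n\<close> by \<open>b = n - e\<close> costs at most
    \<open>2 * n * e \<le> c * d\<close> in the square, less than the \<open>2 * c * d\<close>
    permitted below.\<close>
  define e where "e = min (n / 2) (c * d / (2 * n))"
  have e: "e > 0" "e \<le> n / 2" "2 * n * e \<le> c * d"
    using n assms by (auto simp: e_def min_def field_simps)
  define b where "b = n - e"
  have b: "0 < b" "b < n" using e n by (auto simp: b_def)
  have "\<exists>u. \<not> norm (blinfun_apply f u) \<le> b * norm u"
    using norm_blinfun_bound[of b f] b by (auto simp: n_def)
  then obtain u where u: "b * norm u < \<bar>blinfun_apply f u\<bar>" by (auto simp: not_le)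
  then have u0: "norm u > 0" by auto
  \<comment> \<open>The sign makes the value positive, and the norm \<open>b / c\<close> maximises
    \<open>b * t - c / 2 * t^2\<close> over \<open>t\<close>.\<close>
  define y where "y = (sgn (blinfun_apply f u) * (b / (c * norm u))) *\<^sub>R u"
  have "blinfun_apply f y = \<bar>blinfun_apply f u\<bar> * (b / (c * norm u))"
    by (simp add: y_def blinfun.scaleR_right abs_sgn mult_ac)
  also have "\<dots> \<ge> (b * norm u) * (b / (c * norm u))"
    using u b assms by (intro mult_right_mono) auto
  finally have fy: "blinfun_apply f y \<ge> b\<^sup>2 / c"
    using u0 by (simp add: power2_eq_square)
  have "blinfun_apply f u \<noteq> 0" using u b u0 by (smt (verit) mult_pos_pos)
  then have "norm y = b / c"
    using u0 b assms by (simp add: y_def abs_mult abs_sgn_eq)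
  then have "blinfun_apply f y - c / 2 * (norm y)\<^sup>2 \<ge> b\<^sup>2 / c - c / 2 * (b / c)\<^sup>2" using fy by simp
  also have "b\<^sup>2 / c - c / 2 * (b / c)\<^sup>2 = b\<^sup>2 / (2 * c)"
    using assms by (simp add: field_simps power2_eq_square)
  finally have *: "blinfun_apply f y - c / 2 * (norm y)\<^sup>2 \<ge> b\<^sup>2 / (2 * c)" .
  have "b\<^sup>2 = n\<^sup>2 - 2 * n * e + e\<^sup>2" by (simp add: b_def power2_diff)
  then have "b\<^sup>2 > n\<^sup>2 - 2 * (c * d)" using e assms by (smt (verit) mult_pos_pos zero_le_power2)
  then have "b\<^sup>2 / (2 * c) > (n\<^sup>2 - 2 * (c * d)) / (2 * c)"
    using assms by (intro divide_strict_right_mono) auto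
  then have "b\<^sup>2 / (2 * c) > n\<^sup>2 / (2 * c) - d" using assms by (simp add: diff_divide_distrib)
  then show ?thesis using that[of y] * by (simp add: n_def)
qed

text \<open>Supplies the continuity of the minorant found by Zorn's lemma, which is linear only
  algebraically: the bound is constant on the unit sphere, and homogeneity extends it.\<close>

lemma bounded_linear_if_quadratically_bounded:
  fixes f :: "'a::real_normed_vector \<Rightarrow> real"
  assumes f: "linear f" and b: "\<And>x. f x \<le> C + D * (norm x)\<^sup>2"
  shows "bounded_linear f"
proof -
  have le: "f x \<le> norm x * (C + D)" for x
  proof (cases "x = 0")
    case False
    have "f x / norm x = f (x /\<^sub>R norm x)" by (simp add: linear_scale[OF f] divide_inverse mult.commute)
    also have "\<dots> \<le> C + D" using b[of "x /\<^sub>R norm x"] False by simp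
    finally show ?thesis using False by (simp add: field_simps)
  qed (simp add: linear_0[OF f])
  have "norm (f x) \<le> norm x * (C + D)" for x
    using le[of x] le[of "- x"] by (simp add: linear_neg[OF f])
  then show ?thesis
    using f by (intro bounded_linear_intro[where K = "C + D"]) (auto simp: linear_add linear_scale)
qed

section \<open>Quasidensity and the Fitzpatrick function\<close>

lemma mm_monotoneD:
  assumes "mm_monotone G" "(s, s') \<in> G" "(t, t') \<in> G"
  shows "blinfun_apply (s' - t') (s - t) \<ge> 0"
  using assms by (fastforce simp: mm_monotone_def)

lemma mm_quasidenseE:
  fixes G :: "'a::real_normed_vector graph"
  assumes "mm_quasidense G" "G \<noteq> {}" "e > 0"
  obtains s s' where "(s, s') \<in> G"
    "1/2 * (norm (s - x))\<^sup>2 + 1/2 * (norm (s' - x'))\<^sup>2 + blinfun_apply (s' - x') (s - x) < e"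
proof -
  let ?g = "\<lambda>p. (1/2) * (norm (fst p - x))\<^sup>2 + (1/2) * (norm (snd p - x'))\<^sup>2
                 + blinfun_apply (snd p - x') (fst p - x)"
  have "Inf (?g ` G) < e"
    using assms(1,3) unfolding mm_quasidense_def by (meson le_less_trans)
  then obtain r where "r \<in> ?g ` G" "r < e"
    using cInf_lessD[of "?g ` G" e] assms(2) by auto
  then show ?thesis using that by (auto simp del: One_nat_def)
qed

text \<open>The number \<open>r\<close> bounds the Fitzpatrick function of \<open>G\<close> at \<open>(y, k)\<close>.  If no such point
  existed, a linear functional separating the Fitzpatrick function from the negative weighted
  square norm would be a point of \<open>E* \<times> E**\<close> at which quasidensity fails.\<close>

lemma fitzpatrick_bound_near_antidiagonal:
  fixes G :: "'a::real_normed_vector graph"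
  assumes ne: "G \<noteq> {}" and mono: "mm_monotone G" and qd: "mm_quasidense G" and l: "l > 0" and e: "e > 0"
  obtains y k r where "\<And>s s'. (s, s') \<in> G \<Longrightarrow> blinfun_apply s' y + blinfun_apply k s - blinfun_apply s' s \<le> r"
    "r + l / 2 * (norm y)\<^sup>2 + (norm k)\<^sup>2 / (2 * l) < e"
proof (rule ccontr)
  note witness = that
  assume contra: "\<not> thesis"
  \<comment> \<open>\<open>P\<close> describes the epigraph of the Fitzpatrick function of
    \<open>G\<close>.\<close>
  define P where "P y k r \<longleftrightarrow> (\<forall>(s, s') \<in> G. blinfun_apply s' y + blinfun_apply k s - blinfun_apply s' s \<le> r)"
    for y :: 'a and k and r :: real
  define N where "N y k = l / 2 * (norm y)\<^sup>2 + (norm k)\<^sup>2 / (2 * l)" for y :: 'a and k :: "'a \<Rightarrow>\<^sub>L real"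
  have low: "e \<le> r + N y k" if "P y k r" for y k r
  proof (rule ccontr)
    assume "\<not> e \<le> r + N y k"
    then have "thesis" using that by (intro witness[of y k r]) (auto simp: P_def N_def)
    then show False using contra by blast
  qed
  have Ncv: "N ((1 - t) *\<^sub>R y + t *\<^sub>R z) ((1 - t) *\<^sub>R k + t *\<^sub>R m) \<le> (1 - t) * N y k + t * N z m"
    if "0 < t" "t < 1" for t y z k m
  proof -
    have "l / 2 * (norm ((1 - t) *\<^sub>R y + t *\<^sub>R z))\<^sup>2 \<le> l / 2 * ((1 - t) * (norm y)\<^sup>2 + t * (norm z)\<^sup>2)"
      using l that by (intro mult_left_mono norm_convex_combination_square_le) auto
    moreover have "(norm ((1 - t) *\<^sub>R k + t *\<^sub>R m))\<^sup>2 / (2 * l) \<le> ((1 - t) * (norm k)\<^sup>2 + t * (norm m)\<^sup>2) / (2 * l)"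
      using l that by (intro divide_right_mono norm_convex_combination_square_le) auto
    moreover have "((1 - t) * (norm k)\<^sup>2 + t * (norm m)\<^sup>2) / (2 * l)
        = (1 - t) * ((norm k)\<^sup>2 / (2 * l)) + t * ((norm m)\<^sup>2 / (2 * l))"
      by (simp add: add_divide_distrib)
    moreover have "l / 2 * ((1 - t) * (norm y)\<^sup>2 + t * (norm z)\<^sup>2)
        = (1 - t) * (l / 2 * (norm y)\<^sup>2) + t * (l / 2 * (norm z)\<^sup>2)"
      by (simp add: distrib_left mult.left_commute)
    ultimately show ?thesis unfolding N_def distrib_left by linarith
  qed
  \<comment> \<open>By monotonicity, at points of \<open>G\<close> the Fitzpatrick function is at
    most the pairing.\<close>
  have PG: "P s s' (blinfun_apply s' s)" if "(s, s') \<in> G" for s s'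
    unfolding P_def
  proof safe
    fix t t' assume "(t, t') \<in> G"
    from mm_monotoneD[OF mono that this]
    show "blinfun_apply t' s + blinfun_apply s' t - blinfun_apply t' t \<le> blinfun_apply s' s"
      by (simp add: blinfun.bilinear_simps)
  qed
  have Pcv: "P ((1 - t) *\<^sub>R y + t *\<^sub>R z) ((1 - t) *\<^sub>R k + t *\<^sub>R m) ((1 - t) * r + t * r')"
    if "P y k r" "P z m r'" "0 < t" "t < 1" for t y z k m r r'
    unfolding P_def
  proof safe
    fix s s' assume sG: "(s, s') \<in> G"
    have 1: "(1 - t) * (blinfun_apply s' y + blinfun_apply k s - blinfun_apply s' s) \<le> (1 - t) * r"
      using that sG by (intro mult_left_mono) (auto simp: P_def)
    have 2: "t * (blinfun_apply s' z + blinfun_apply m s - blinfun_apply s' s) \<le> t * r'"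
      using that sG by (intro mult_left_mono) (auto simp: P_def)
    from 1 2 show "blinfun_apply s' ((1 - t) *\<^sub>R y + t *\<^sub>R z) + blinfun_apply ((1 - t) *\<^sub>R k + t *\<^sub>R m) s
        - blinfun_apply s' s \<le> (1 - t) * r + t * r'"
      by (simp add: blinfun.bilinear_simps algebra_simps)
  qed
  \<comment> \<open>\<open>Inf (S p)\<close> is the infimal convolution of the reflected Fitzpatrick
    function with \<open>N\<close>, lowered by \<open>e\<close>; by \<open>low\<close> it is
    nonnegative at 0.\<close>
  define S where "S p = {r + N (fst p + y) (snd p + k) - e | y k r. P y k r}" for p
  obtain a a' where aG: "(a, a') \<in> G" using ne by auto
  have S_ne: "S p \<noteq> {}" for p unfolding S_def using PG[OF aG] by blast
  have S_pos: "0 \<le> r" if "r \<in> S 0" for r using that low by (auto simp: S_def)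
  have S_cv: "\<exists>q \<in> S ((1 - t) *\<^sub>R x + t *\<^sub>R y). q \<le> (1 - t) * r + t * s"
    if rs: "r \<in> S x" "s \<in> S y" and t: "0 < t" "t < 1" for x y r s t
  proof -
    obtain y1 k1 r1 where 1: "r = r1 + N (fst x + y1) (snd x + k1) - e" "P y1 k1 r1"
      using rs by (auto simp: S_def)
    obtain y2 k2 r2 where 2: "s = r2 + N (fst y + y2) (snd y + k2) - e" "P y2 k2 r2"
      using rs by (auto simp: S_def)
    define z where "z = (1 - t) *\<^sub>R x + t *\<^sub>R y"
    define y3 where "y3 = (1 - t) *\<^sub>R y1 + t *\<^sub>R y2"
    define k3 where "k3 = (1 - t) *\<^sub>R k1 + t *\<^sub>R k2"
    define r3 where "r3 = (1 - t) * r1 + t * r2"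
    have "P y3 k3 r3" unfolding y3_def k3_def r3_def by (rule Pcv[OF 1(2) 2(2) t])
    then have "r3 + N (fst z + y3) (snd z + k3) - e \<in> S z" unfolding S_def by blast
    have z_eqs: "fst z + y3 = (1 - t) *\<^sub>R (fst x + y1) + t *\<^sub>R (fst y + y2)"
      "snd z + k3 = (1 - t) *\<^sub>R (snd x + k1) + t *\<^sub>R (snd y + k2)"
      by (auto simp: z_def y3_def k3_def algebra_simps)
    have "N (fst z + y3) (snd z + k3) \<le> (1 - t) * N (fst x + y1) (snd x + k1) + t * N (fst y + y2) (snd y + k2)"
      unfolding z_eqs by (rule Ncv[OF t])
    then have "r3 + N (fst z + y3) (snd z + k3) - e \<le> (1 - t) * r + t * s"
      by (simp add: r3_def 1(1) 2(1) algebra_simps)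
    with \<open>_ \<in> S z\<close> show ?thesis unfolding z_def by blast
  qed
  obtain L where L: "linear L" and LF: "\<And>p. L p \<le> Inf (S p)"
    using convex_linear_minorant[OF convex_on_Inf_family[OF S_ne S_pos S_cv] Inf_family_nonneg[OF S_ne S_pos S_cv]]
    by blast
  \<comment> \<open>Taking the graph point itself as the point of the epigraph cancels the shift by
    \<open>(s, s')\<close> inside \<open>N\<close>.\<close>
  have LG: "L (x, x') \<le> L (s, s') + blinfun_apply s' s + N x x' - e" if "(s, s') \<in> G" for s s' x x'
  proof -
    have "blinfun_apply s' s + N (fst ((x, x') - (s, s')) + s) (snd ((x, x') - (s, s')) + s') - e \<in> S ((x, x') - (s, s'))"
      unfolding S_def using PG[OF that] by blast
    then have "Inf (S ((x, x') - (s, s'))) \<le> blinfun_apply s' s + N x x' - e"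
      using bdd_below_convex_family[OF S_ne S_pos S_cv] cInf_lower by fastforce
    then show ?thesis using LF[of "(x, x') - (s, s')"] linear_diff[OF L, of "(x, x')" "(s, s')"] by linarith
  qed
  \<comment> \<open>At the fixed graph point \<open>(a, a')\<close>, \<open>LG\<close> bounds each
    component of \<open>L\<close> quadratically. So the components are continuous: one lies in the
    dual, the other in the bidual.\<close>
  define M where "M = L (a, a') + blinfun_apply a' a - e"
  have Lsplit: "L (x, x') = L (x, 0) + L (0, x')" for x x'
    using linear_add[OF L, of "(x, 0)" "(0, x')"] by simp
  have "linear (\<lambda>x. L (x, 0))"
    using linear_compose[OF _ L, of "\<lambda>x. (x, 0)"] by (simp add: o_def linear_iff)
  moreover have "L (x, 0) \<le> M + l / 2 * (norm x)\<^sup>2" for x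
    using LG[OF aG, of x 0] by (simp add: M_def N_def)
  ultimately have bl1: "bounded_linear (\<lambda>x. L (x, 0))" by (rule bounded_linear_if_quadratically_bounded)
  have "linear (\<lambda>x. L (0, x))"
    using linear_compose[OF _ L, of "\<lambda>x. (0, x)"] by (simp add: o_def linear_iff)
  moreover have "L (0, x) \<le> M + 1 / (2 * l) * (norm x)\<^sup>2" for x
    using LG[OF aG, of 0 x] by (simp add: M_def N_def)
  ultimately have bl2: "bounded_linear (\<lambda>x. L (0, x))" by (rule bounded_linear_if_quadratically_bounded)
  define \<xi> where "\<xi> = Blinfun (\<lambda>x. L (x, 0))"
  define \<eta> where "\<eta> = Blinfun (\<lambda>x. L (0, x))"
  have Leq: "L (x, x') = blinfun_apply \<xi> x + blinfun_apply \<eta> x'" for x x'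
    unfolding \<xi>_def \<eta>_def bounded_linear_Blinfun_apply[OF bl1] bounded_linear_Blinfun_apply[OF bl2]
    by (rule Lsplit)
  define d where "d = e / 4"
  have d: "d > 0" using e by (simp add: d_def)
  \<comment> \<open>\<open>y\<close> nearly attains the conjugate at \<open>\<xi>\<close> for the
    rescaled norm, \<open>j\<close> that at \<open>\<eta>\<close> for the original dual norm.
    Quasidensity is then applied at \<open>(0, - \<xi> - j)\<close>.\<close>
  obtain y where y: "blinfun_apply \<xi> y - l / 2 * (norm y)\<^sup>2 > (norm \<xi>)\<^sup>2 / (2 * l) - d"
    using blinfun_half_square_conjugate[OF l d] by blast
  obtain j where j: "blinfun_apply \<eta> j - 1 / 2 * (norm j)\<^sup>2 > (norm \<eta>)\<^sup>2 / (2 * 1) - d"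
    using blinfun_half_square_conjugate[OF zero_less_one d] by blast
  obtain s s' where sG: "(s, s') \<in> G" and s:
    "1/2 * (norm (s - 0))\<^sup>2 + 1/2 * (norm (s' - (- \<xi> - j)))\<^sup>2 + blinfun_apply (s' - (- \<xi> - j)) (s - 0) < d"
    using mm_quasidenseE[OF qd ne d] by blast
  define m where "m = s' - (- \<xi> - j)"
  have s'_eq: "s' = m - \<xi> - j" by (simp add: m_def)
  \<comment> \<open>In \<open>LG\<close> at \<open>(y, - \<xi>)\<close> the terms in
    \<open>y\<close> and the square norm of \<open>\<xi>\<close> cancel up to \<open>d\<close>; here
    the scale \<open>l\<close> drops out.\<close>
  have "blinfun_apply \<xi> y - blinfun_apply \<eta> \<xi> \<le> L (s, s') + blinfun_apply s' s + N y (- \<xi>) - e"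
    using LG[OF sG, of y "- \<xi>"] by (simp add: Leq[of y] blinfun.minus_right)
  then have lower: "- blinfun_apply \<eta> \<xi> - d < L (s, s') + blinfun_apply s' s - e"
    using y by (simp add: N_def)
  \<comment> \<open>The form of \<open>s'\<close> cancels the value of \<open>\<xi>\<close> at
    \<open>s\<close>. Bounding \<open>\<eta>\<close> at \<open>m\<close> and \<open>j\<close> at
    \<open>s\<close> by half squares brings in the quasidensity estimate and the choice of
    \<open>j\<close>. The two bounds clash because \<open>3 * d < e\<close>.\<close>
  have "L (s, s') + blinfun_apply s' s
      = blinfun_apply \<eta> m - blinfun_apply \<eta> \<xi> - blinfun_apply \<eta> j + blinfun_apply m s - blinfun_apply j s"
    by (simp add: Leq s'_eq blinfun.bilinear_simps)
  moreover have "blinfun_apply \<eta> m \<le> 1/2 * (norm m)\<^sup>2 + (norm \<eta>)\<^sup>2 / 2"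
    using abs_blinfun_le_weighted_squares[of 1 \<eta> m] by simp
  moreover have "- blinfun_apply j s \<le> 1/2 * (norm s)\<^sup>2 + (norm j)\<^sup>2 / 2"
    using abs_blinfun_le_weighted_squares[of 1 j s] by simp
  moreover have "1/2 * (norm s)\<^sup>2 + 1/2 * (norm m)\<^sup>2 + blinfun_apply m s < d"
    using s by (simp add: m_def)
  ultimately have "L (s, s') + blinfun_apply s' s < - blinfun_apply \<eta> \<xi> + 2 * d"
    using j by simp
  with lower e show False unfolding d_def by linarith
qed


section \<open>Quasidensity in the rescaled norm\<close>

text \<open>Quasidensity in the original norm is applied at a point \<open>(y, k)\<close> where the
  Fitzpatrick bound plus the rescaled half square is small. The Fitzpatrick bound controls the
  pairing of the differences, so the graph point found is close to \<open>(y, k)\<close> and the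
  rescaled expression changes little.\<close>

lemma quasidense_scaled_origin:
  fixes G :: "'a::real_normed_vector graph"
  assumes ne: "G \<noteq> {}" and mono: "mm_monotone G" and qd: "mm_quasidense G" and l: "l > 0" and e: "e > 0"
  obtains s s' where "(s, s') \<in> G"
    "l / 2 * (norm s)\<^sup>2 + (norm s')\<^sup>2 / (2 * l) + blinfun_apply s' s < e"
proof -
  obtain t t' where tG: "(t, t') \<in> G" using ne by auto
  \<comment> \<open>\<open>M\<close>, \<open>R\<close> and \<open>K\<close> depend only on
    \<open>l\<close> and the fixed point \<open>(t, t')\<close>, so \<open>h\<close> and
    \<open>d\<close> can be chosen before \<open>(y, k)\<close> is known.\<close>
  define M where "M = 1 + blinfun_apply t' t + (norm t')\<^sup>2 / l + l * (norm t)\<^sup>2"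
  define R where "R = 1 + \<bar>4 * M / l\<bar> + \<bar>4 * M * l\<bar>"
  define K where "K = 1 + l * (R + 1/2) + (R + 1/2) / l + 2 * R + 1"
  have R: "R \<ge> 1" by (simp add: R_def)
  have K: "K > 0" using R l by (auto simp: K_def intro!: add_pos_pos)
  define h where "h = min 1 (e / K)"
  have h: "h > 0" "h \<le> 1" "h * K \<le> e" using K e by (auto simp: h_def min_def field_simps)
  define d where "d = h\<^sup>2 / 4"
  have hh: "h\<^sup>2 \<le> h" using h by (simp add: power2_eq_square mult_left_le)
  have d: "d > 0" "d \<le> 1" "4 * d = h\<^sup>2" using h hh by (auto simp: d_def)
  obtain y k r where r: "\<And>s s'. (s, s') \<in> G \<Longrightarrow> blinfun_apply s' y + blinfun_apply k s - blinfun_apply s' s \<le> r"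
    and rN: "r + l / 2 * (norm y)\<^sup>2 + (norm k)\<^sup>2 / (2 * l) < d"
    using fitzpatrick_bound_near_antidiagonal[OF ne mono qd l d(1)] by blast
  \<comment> \<open>The graph point \<open>(t, t')\<close> bounds \<open>r\<close> from below at the
    cost of half of the weighted squares; the other half remains and is bounded.\<close>
  have bd: "l / 4 * (norm y)\<^sup>2 + (norm k)\<^sup>2 / (4 * l) \<le> M"
  proof -
    have "- blinfun_apply t' y \<le> l / 4 * (norm y)\<^sup>2 + (norm t')\<^sup>2 / l"
      using abs_blinfun_le_weighted_squares[of "l / 2" t' y] l by simp
    moreover have "- blinfun_apply k t \<le> l * (norm t)\<^sup>2 + (norm k)\<^sup>2 / (4 * l)"
      using abs_blinfun_le_weighted_squares[of "2 * l" k t] l by simp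
    moreover have "(norm k)\<^sup>2 / (2 * l) = (norm k)\<^sup>2 / (4 * l) + (norm k)\<^sup>2 / (4 * l)" by (simp add: field_simps)
    ultimately show ?thesis using r[OF tG] rN d(2) by (simp add: M_def)
  qed
  have le_sq: "x \<le> 1 + c" if "x\<^sup>2 \<le> c" for x c :: real
  proof -
    have "0 \<le> (x - 1/2)\<^sup>2" by simp
    then have "x \<le> x\<^sup>2 + 1/4" by (simp add: power2_diff power_divide)
    then show ?thesis using that by linarith
  qed
  have "0 \<le> (norm k)\<^sup>2 / (4 * l)" "0 \<le> l / 4 * (norm y)\<^sup>2" using l by auto
  then have "l / 4 * (norm y)\<^sup>2 \<le> M" "(norm k)\<^sup>2 / (4 * l) \<le> M" using bd by linarith+
  then have "(norm y)\<^sup>2 \<le> 4 * M / l" "(norm k)\<^sup>2 \<le> 4 * M * l" using l by (auto simp: field_simps)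
  then have yk: "norm y \<le> R" "norm k \<le> R" 
    using le_sq[of "norm y" "4 * M / l"] le_sq[of "norm k" "4 * M * l"] unfolding R_def by linarith+
  obtain s s' where sG: "(s, s') \<in> G" and s:
    "1/2 * (norm (s - y))\<^sup>2 + 1/2 * (norm (s' - k))\<^sup>2 + blinfun_apply (s' - k) (s - y) < d"
    using mm_quasidenseE[OF qd ne d(1)] by blast
  define u where "u = s - y"
  define v where "v = s' - k"
  have sv: "s = y + u" "s' = k + v" by (auto simp: u_def v_def)
  have uv: "1/2 * (norm u)\<^sup>2 + 1/2 * (norm v)\<^sup>2 + blinfun_apply v u < d" using s by (simp add: u_def v_def)
  have rs: "blinfun_apply k y - blinfun_apply v u \<le> r"
    using r[OF sG] by (simp add: sv blinfun.bilinear_simps)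
  have ky: "\<bar>blinfun_apply k y\<bar> \<le> l / 2 * (norm y)\<^sup>2 + (norm k)\<^sup>2 / (2 * l)"
    by (rule abs_blinfun_le_weighted_squares[OF l])
  \<comment> \<open>\<open>rs\<close>, \<open>ky\<close> and \<open>rN\<close> make the pairing of
    \<open>v\<close> and \<open>u\<close> larger than \<open>- d\<close>, so the squares sum to less
    than \<open>4 * d\<close>.\<close>
  have small: "(norm u)\<^sup>2 + (norm v)\<^sup>2 < h\<^sup>2" using uv rs ky rN d(3) by linarith
  then have "(norm u)\<^sup>2 < h\<^sup>2" "(norm v)\<^sup>2 < h\<^sup>2"
    using zero_le_power2[of "norm u"] zero_le_power2[of "norm v"] by linarith+
  then have uvh: "norm u \<le> h" "norm v \<le> h" using h by (auto intro: power2_le_imp_le less_imp_le)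
  have "blinfun_apply v u < d" using uv zero_le_power2[of "norm u"] zero_le_power2[of "norm v"] by linarith
  then have base: "l / 2 * (norm y)\<^sup>2 + (norm k)\<^sup>2 / (2 * l) + blinfun_apply k y < h"
    using rs rN d hh h by linarith
  have sq: "(norm (p + w))\<^sup>2 \<le> (norm p)\<^sup>2 + h * (2 * R + 1)" if "norm p \<le> R" "norm w \<le> h" for p w :: "'c::real_normed_vector"
  proof -
    have "(norm (p + w))\<^sup>2 \<le> (norm p + norm w)\<^sup>2" by (intro power_mono norm_triangle_ineq) auto
    also have "\<dots> = (norm p)\<^sup>2 + 2 * (norm p * norm w) + (norm w)\<^sup>2" by (simp add: power2_sum)
    also have "norm p * norm w \<le> R * h" using that R by (intro mult_mono) auto
    also have "(norm w)\<^sup>2 \<le> h" using power_mono[OF that(2), of 2] hh by simp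
    finally show ?thesis by (simp add: algebra_simps)
  qed
  have "l / 2 * (norm s)\<^sup>2 \<le> l / 2 * ((norm y)\<^sup>2 + h * (2 * R + 1))"
    unfolding sv using l sq[OF yk(1) uvh(1)] by (intro mult_left_mono) auto
  also have "\<dots> = l / 2 * (norm y)\<^sup>2 + h * (l * (R + 1/2))" by (simp add: algebra_simps)
  finally have 1: "l / 2 * (norm s)\<^sup>2 \<le> l / 2 * (norm y)\<^sup>2 + h * (l * (R + 1/2))" .
  have "(norm s')\<^sup>2 / (2 * l) \<le> ((norm k)\<^sup>2 + h * (2 * R + 1)) / (2 * l)"
    unfolding sv using l sq[OF yk(2) uvh(2)] by (intro divide_right_mono) auto
  also have "\<dots> = (norm k)\<^sup>2 / (2 * l) + h * ((R + 1/2) / l)" using l by (simp add: field_simps)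
  finally have 2: "(norm s')\<^sup>2 / (2 * l) \<le> (norm k)\<^sup>2 / (2 * l) + h * ((R + 1/2) / l)" .
  have "blinfun_apply k u \<le> R * h" "blinfun_apply v y \<le> R * h" "blinfun_apply v u \<le> 1 * h"
    using abs_blinfun_le[of k u] abs_blinfun_le[of v y] abs_blinfun_le[of v u]
      mult_mono[OF yk(2) uvh(1)] mult_mono[OF yk(1) uvh(2)] mult_mono[OF order_trans[OF uvh(1) h(2)] uvh(2)] R h
    by (auto simp: mult.commute)
  then have 3: "blinfun_apply s' s \<le> blinfun_apply k y + h * (2 * R + 1)"
    by (simp add: sv blinfun.bilinear_simps algebra_simps)
  have "l / 2 * (norm s)\<^sup>2 + (norm s')\<^sup>2 / (2 * l) + blinfun_apply s' s
      < h + h * (l * (R + 1/2)) + h * ((R + 1/2) / l) + h * (2 * R + 1)"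
    using 1 2 3 base by linarith
  also have "\<dots> = h * K" by (simp add: K_def distrib_left)
  finally show ?thesis using h(3) that[OF sG] by linarith
qed

text \<open>Monotonicity and quasidensity survive the translation of the graph that moves
  \<open>(x, x')\<close> to the origin.\<close>

lemma quasidense_scaled:
  fixes G :: "'a::real_normed_vector graph"
  assumes ne: "G \<noteq> {}" and mono: "mm_monotone G" and qd: "mm_quasidense G" and l: "l > 0" and e: "e > 0"
  obtains s s' where "(s, s') \<in> G"
    "l / 2 * (norm (s - x))\<^sup>2 + (norm (s' - x'))\<^sup>2 / (2 * l) + blinfun_apply (s' - x') (s - x) < e"
proof -
  let ?H = "(\<lambda>p. p - (x, x')) ` G"
  have "mm_monotone ?H"
    using mono by (auto simp: mm_monotone_def split_beta image_iff)
  moreover have "mm_quasidense ?H"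
    unfolding mm_quasidense_def
  proof (intro allI)
    fix z z'
    show "(INF p \<in> ?H. (1/2) * (norm (fst p - z))\<^sup>2 + (1/2) * (norm (snd p - z'))\<^sup>2
                 + blinfun_apply (snd p - z') (fst p - z)) \<le> 0"
      using qd[unfolded mm_quasidense_def, rule_format, of "x + z" "x' + z'"]
      by (simp add: image_image diff_diff_eq)
  qed
  moreover have "?H \<noteq> {}" using ne by simp
  ultimately obtain s s' where H: "(s, s') \<in> ?H"
    and s: "l / 2 * (norm s)\<^sup>2 + (norm s')\<^sup>2 / (2 * l) + blinfun_apply s' s < e"
    by (metis quasidense_scaled_origin l e)
  then have "(s + x, s' + x') \<in> G" by auto
  then show ?thesis using s by (intro that[of "s + x" "s' + x'"]) auto
qed

section \<open>Approach to the domain and type (FPV)\<close>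

text \<open>In the monotonicity relation with \<open>(y, y')\<close> the weighted Young inequality
  absorbs the square of \<open>s' - x'\<close>. What remains compares a quadratic term with factor
  \<open>l\<close> to terms linear in the distance, so large \<open>l\<close> pushes that distance
  below any radius exceeding \<open>norm (y - z)\<close>.\<close>

lemma scaled_solution_near_domain:
  fixes G :: "'a::real_normed_vector graph"
  assumes mono: "mm_monotone G" and yG: "(y, y') \<in> G" and near: "norm (y - z) < \<rho>"
  obtains l0 where "l0 > 0" "\<And>l s s'. l \<ge> l0 \<Longrightarrow> (s, s') \<in> G \<Longrightarrow>
    l / 2 * (norm (s - z))\<^sup>2 + (norm (s' - x'))\<^sup>2 / (2 * l) + blinfun_apply (s' - x') (s - z) < 1 \<Longrightarrow>
    norm (s - z) < \<rho>"
proof -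
  define m where "m = norm (y - z)"
  define K where "K = norm (y' - x')"
  define l0 where "l0 = 2 * (1 / \<rho> + K + 1) / (\<rho> - m)"
  have m: "0 \<le> m" "m < \<rho>" using near by (auto simp: m_def)
  have K: "K \<ge> 0" by (simp add: K_def)
  have l0: "l0 > 0" unfolding l0_def using m K
    by (intro divide_pos_pos mult_pos_pos add_nonneg_pos add_nonneg_nonneg) auto
  show ?thesis
  proof (rule that[OF l0], rule ccontr)
    fix l s s'
    assume l: "l \<ge> l0" and sG: "(s, s') \<in> G"
      and s: "l / 2 * (norm (s - z))\<^sup>2 + (norm (s' - x'))\<^sup>2 / (2 * l) + blinfun_apply (s' - x') (s - z) < 1"
      and "\<not> norm (s - z) < \<rho>"
    define b where "b = s - z"
    define j where "j = s' - x'"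
    have lpos: "l > 0" using l l0 by simp
    have B: "norm b \<ge> \<rho>" using \<open>\<not> norm (s - z) < \<rho>\<close> by (simp add: b_def)
    have split: "blinfun_apply (s' - y') (s - y)
        = blinfun_apply j b - blinfun_apply j (y - z) - blinfun_apply (y' - x') (b - (y - z))"
      by (simp add: b_def j_def blinfun.bilinear_simps algebra_simps)
    have "\<bar>blinfun_apply (y' - x') (b - (y - z))\<bar> \<le> norm (b - (y - z)) * K"
      unfolding K_def by (rule abs_blinfun_le)
    also have "\<dots> \<le> (norm b + m) * K"
      unfolding m_def using K by (intro mult_right_mono norm_triangle_ineq4)
    finally have 1: "\<bar>blinfun_apply (y' - x') (b - (y - z))\<bar> \<le> (norm b + m) * K" .
    have 2: "\<bar>blinfun_apply j (y - z)\<bar> \<le> l / 2 * m\<^sup>2 + (norm j)\<^sup>2 / (2 * l)"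
      unfolding m_def by (rule abs_blinfun_le_weighted_squares[OF lpos])
    have "l / 2 * (norm b)\<^sup>2 - l / 2 * m\<^sup>2 < 1 + (norm b + m) * K"
      using mm_monotoneD[OF mono sG yG] split 1 2 s by (simp add: b_def j_def)
    \<comment> \<open>Since \<open>norm b \<ge> \<rho>\<close>, the constant 1 also acquires the
      factor \<open>norm b + m\<close>, which then cancels.\<close>
    also have "1 \<le> (norm b + m) * (1 / \<rho>)" using B m by (simp add: field_simps)
    finally have "(norm b + m) * (l / 2 * (norm b - m)) < (norm b + m) * (1 / \<rho> + K)"
      by (simp add: algebra_simps power2_eq_square)
    then have "l / 2 * (norm b - m) < 1 / \<rho> + K"
      using B m by (simp add: mult_less_cancel_left_pos)
    moreover have "l / 2 * (norm b - m) \<ge> l0 / 2 * (\<rho> - m)"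
      using l lpos B m l0 by (intro mult_mono) auto
    moreover have "l0 / 2 * (\<rho> - m) = 1 / \<rho> + K + 1" 
      using m unfolding l0_def by (simp only: times_divide_eq_left) (simp add: nonzero_divide_eq_eq)
    ultimately show False by simp
  qed
qed

text \<open>Adding \<open>h\<close> times the local monotonicity relation with \<open>(w, w')\<close> and \<open>1 - h\<close> times the
  monotonicity relation with a graph point near \<open>z\<close> eliminates the direction \<open>w - z\<close>.\<close>

lemma closure_domain_step:
  fixes G :: "'a::real_normed_vector graph"
  assumes ne: "G \<noteq> {}" and mono: "mm_monotone G" and qd: "mm_quasidense G"
    and loc: "\<And>s s'. (s, s') \<in> G \<Longrightarrow> s \<in> U \<Longrightarrow> blinfun_apply (s' - w') (s - w) \<ge> 0"
    and z: "z \<in> closure (mm_dom G)" and h: "0 \<le> h" "h \<le> 1"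
    and z2: "z2 = z + h *\<^sub>R (w - z)" and ball: "ball z2 \<rho> \<subseteq> U" and near: "norm (z - z2) < \<rho>"
  shows "z2 \<in> closure (mm_dom G)"
  unfolding closure_approachable
proof (intro allI impI)
  fix e :: real assume e: "0 < e"
  \<comment> \<open>\<open>\<eta>\<close> serves the accuracy \<open>e\<close> and also keeps
    \<open>y\<close> inside the ball of radius \<open>\<rho>\<close> about
    \<open>z2\<close>.\<close>
  define \<eta> where "\<eta> = min (e / 2) (\<rho> - norm (z - z2))"
  have \<eta>: "\<eta> > 0" "\<eta> \<le> e / 2" "\<eta> \<le> \<rho> - norm (z - z2)"
    unfolding \<eta>_def using e near by (simp, intro min.cobounded1, intro min.cobounded2)
  obtain y y' where yG: "(y, y') \<in> G" and y: "norm (y - z) < \<eta>"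
    using z \<eta>(1) unfolding closure_approachable mm_dom_def dist_norm by fastforce
  define m where "m = norm (y - z2)"
  have m: "m < \<rho>" using y \<eta>(3) norm_triangle_ineq[of "y - z" "z - z2"] by (simp add: m_def)
  define K where "K = norm (y' - w')"
  have K: "K \<ge> 0" by (simp add: K_def)
  obtain l0 where l0: "l0 > 0" and stay: "\<And>l s s'. l \<ge> l0 \<Longrightarrow> (s, s') \<in> G \<Longrightarrow>
    l / 2 * (norm (s - z2))\<^sup>2 + (norm (s' - w'))\<^sup>2 / (2 * l) + blinfun_apply (s' - w') (s - z2) < 1 \<Longrightarrow>
    norm (s - z2) < \<rho>"
    using scaled_solution_near_domain[OF mono yG m[unfolded m_def]] by blast
  \<comment> \<open>The first bound keeps \<open>s\<close> in the ball; the second makes the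
    constant \<open>1 + 2 * \<rho> * K\<close> at most \<open>l / 2 * \<eta>^2\<close>.\<close>
  define l where "l = max l0 (2 * (1 + 2 * \<rho> * K) / \<eta>\<^sup>2)"
  have l: "l \<ge> l0" "l > 0" "2 * (1 + 2 * \<rho> * K) / \<eta>\<^sup>2 \<le> l" using l0 by (auto simp: l_def)
  obtain s s' where sG: "(s, s') \<in> G" and s:
    "l / 2 * (norm (s - z2))\<^sup>2 + (norm (s' - w'))\<^sup>2 / (2 * l) + blinfun_apply (s' - w') (s - z2) < 1"
    using quasidense_scaled[OF ne mono qd l(2) zero_less_one] by blast
  have s\<rho>: "norm (s - z2) < \<rho>" by (rule stay[OF l(1) sG s])
  then have "s \<in> U" using ball by (auto simp: dist_norm norm_minus_commute)
  define b where "b = s - z2"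
  define j where "j = s' - w'"
  have j1: "0 \<le> blinfun_apply j b - (1 - h) * blinfun_apply j (w - z)"
  proof -
    have "s - w = b - (1 - h) *\<^sub>R (w - z)" by (simp add: b_def z2 algebra_simps)
    then show ?thesis using loc[OF sG \<open>s \<in> U\<close>] by (simp add: j_def blinfun.diff_right blinfun.scaleR_right)
  qed
  have j2: "0 \<le> blinfun_apply j b + h * blinfun_apply j (w - z) + (\<eta> * norm j + 2 * \<rho> * K)"
  proof -
    have "s - y = b + h *\<^sub>R (w - z) - (y - z)" by (simp add: b_def z2)
    then have "blinfun_apply j (s - y) = blinfun_apply j b + h * blinfun_apply j (w - z) - blinfun_apply j (y - z)"
      by (simp add: blinfun.bilinear_simps)
    moreover have "blinfun_apply (s' - y') (s - y) = blinfun_apply j (s - y) - blinfun_apply (y' - w') (s - y)"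
      by (simp add: j_def blinfun.bilinear_simps)
    moreover have "\<bar>blinfun_apply j (y - z)\<bar> \<le> \<eta> * norm j"
      using abs_blinfun_le[of j "y - z"] mult_right_mono[OF less_imp_le[OF y], of "norm j"] by simp
    moreover have "norm (s - y) \<le> 2 * \<rho>"
      using norm_triangle_ineq4[of "s - z2" "y - z2"] s\<rho> m by (simp add: m_def)
    then have "\<bar>blinfun_apply (y' - w') (s - y)\<bar> \<le> 2 * \<rho> * K"
      using abs_blinfun_le[of "y' - w'" "s - y"] mult_right_mono[OF _ K] unfolding K_def by (meson order_trans)
    ultimately show ?thesis using mm_monotoneD[OF mono sG yG] by linarith
  qed
  have "0 \<le> \<rho>" using near norm_ge_zero[of "z - z2"] by linarith
  then have c: "0 \<le> \<eta> * norm j + 2 * \<rho> * K" using \<eta> K by simp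
  have "0 \<le> h * (blinfun_apply j b - (1 - h) * blinfun_apply j (w - z))
      + (1 - h) * (blinfun_apply j b + h * blinfun_apply j (w - z) + (\<eta> * norm j + 2 * \<rho> * K))"
    using h by (intro add_nonneg_nonneg mult_nonneg_nonneg[OF _ j1] mult_nonneg_nonneg[OF _ j2]) auto
  also have "\<dots> = blinfun_apply j b + (1 - h) * (\<eta> * norm j + 2 * \<rho> * K)" by (simp add: algebra_simps)
  also have "\<dots> \<le> blinfun_apply j b + (\<eta> * norm j + 2 * \<rho> * K)"
    using h c mult_left_le_one_le[OF c, of "1 - h"] by simp
  finally have "- blinfun_apply j b \<le> \<eta> * norm j + 2 * \<rho> * K" by simp
  \<comment> \<open>The square of \<open>norm j\<close> on the right is exactly the one present in
    \<open>s\<close>, so the unknown size of \<open>j\<close> disappears.\<close>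
  moreover have "\<eta> * norm j \<le> l / 2 * \<eta>\<^sup>2 + (norm j)\<^sup>2 / (2 * l)"
    by (rule mult_le_weighted_squares[OF l(2)])
  ultimately have "l / 2 * (norm b)\<^sup>2 < l / 2 * \<eta>\<^sup>2 + (1 + 2 * \<rho> * K)"
    using s by (simp add: b_def j_def)
  also have "1 + 2 * \<rho> * K \<le> l / 2 * \<eta>\<^sup>2" using l(3) \<eta>(1) by (simp add: field_simps)
  finally have "l * (norm b)\<^sup>2 < l * (2 * \<eta>\<^sup>2)" by simp
  then have "(norm b)\<^sup>2 < 2 * \<eta>\<^sup>2" using l(2) by (simp add: mult_less_cancel_left_pos)
  also have "\<dots> \<le> (2 * \<eta>)\<^sup>2" by (simp add: power2_eq_square)
  finally have "norm b < 2 * \<eta>" by (rule power2_less_imp_less) (use \<eta>(1) in simp)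
  then have "dist s z2 < e" using \<eta>(2) by (simp add: dist_norm b_def)
  then show "\<exists>x\<in>mm_dom G. dist x z2 < e" using sG by (force simp: mm_dom_def)
qed

text \<open>By openness and convexity, balls of one fixed radius about all points of the segment lie
  in \<open>U\<close>. Steps shorter than this radius carry membership in the closure from
  \<open>y\<close> to \<open>w\<close>.\<close>

lemma closure_domain_segment:
  fixes G :: "'a::real_normed_vector graph"
  assumes mono: "mm_monotone G" and qd: "mm_quasidense G"
    and loc: "\<And>s s'. (s, s') \<in> G \<Longrightarrow> s \<in> U \<Longrightarrow> blinfun_apply (s' - w') (s - w) \<ge> 0"
    and U: "open U" "convex U" and w: "w \<in> U" and y: "y \<in> U" "y \<in> mm_dom G"
  shows "w \<in> closure (mm_dom G)"
proof -
  have ne: "G \<noteq> {}" using y by (auto simp: mm_dom_def)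
  obtain r1 r2 where r: "r1 > 0" "ball w r1 \<subseteq> U" "r2 > 0" "ball y r2 \<subseteq> U"
    using U w y by (meson openE)
  define \<rho> where "\<rho> = min r1 r2"
  have \<rho>: "\<rho> > 0" using r by (simp add: \<rho>_def)
  have ball: "ball (y + t *\<^sub>R (w - y)) \<rho> \<subseteq> U" if "0 \<le> t" "t \<le> 1" for t
  proof
    fix x assume x: "x \<in> ball (y + t *\<^sub>R (w - y)) \<rho>"
    define d where "d = x - (y + t *\<^sub>R (w - y))"
    have "norm d < \<rho>" using x by (simp add: d_def dist_norm norm_minus_commute)
    then have "y + d \<in> ball y r2" "w + d \<in> ball w r1" by (auto simp: dist_norm \<rho>_def)
    then have "(1 - t) *\<^sub>R (y + d) + t *\<^sub>R (w + d) \<in> U"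
      using that r by (intro convexD_alt[OF U(2)]) auto
    moreover have "(1 - t) *\<^sub>R (y + d) + t *\<^sub>R (w + d) = x" by (simp add: d_def algebra_simps)
    ultimately show "x \<in> U" by simp
  qed
  obtain n :: nat where n: "norm (w - y) / \<rho> < real n"
    using reals_Archimedean2 by blast
  then have "0 < real n" using \<rho> by (intro le_less_trans[OF _ n]) simp
  with n have n: "norm (w - y) / \<rho> < real n" "n > 0" by auto
  define p where "p k = y + (real k / real n) *\<^sub>R (w - y)" for k
  have "p k \<in> closure (mm_dom G)" if "k \<le> n" for k
    using that
  proof (induction k)
    case 0
    then show ?case using y closure_subset by (auto simp: p_def)
  next
    case (Suc k)
    \<comment> \<open>Each step covers this fraction of the remaining way, so all steps have equal
      length and the last one has \<open>h = 1\<close>.\<close>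
    define h where "h = 1 / (real n - real k)"
    have h: "0 \<le> h" "h \<le> 1" using Suc.prems by (auto simp: h_def field_simps)
    have "h * (1 - real k / real n) = 1 / real n"
      using Suc.prems n by (simp add: h_def field_simps)
    moreover have "w - p k = (1 - real k / real n) *\<^sub>R (w - y)" by (simp add: p_def algebra_simps)
    ultimately have step: "h *\<^sub>R (w - p k) = (1 / real n) *\<^sub>R (w - y)" by simp
    have eq: "p (Suc k) = p k + h *\<^sub>R (w - p k)"
      unfolding step by (simp add: p_def add_divide_distrib scaleR_add_left)
    have "norm (p k - p (Suc k)) = norm (w - y) / real n" unfolding eq step by simp
    also have "\<dots> < \<rho>" using n \<rho> by (simp add: field_simps)
    finally have near: "norm (p k - p (Suc k)) < \<rho>" .
    show ?case
    proof (rule closure_domain_step[OF ne mono qd loc _ h eq _ near])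
      show "p k \<in> closure (mm_dom G)" using Suc by simp
      show "ball (p (Suc k)) \<rho> \<subseteq> U"
        unfolding p_def using Suc.prems n by (intro ball) auto
    qed
  qed
  from this[of n] show ?thesis using n by (simp add: p_def)
qed

lemma closed_monotone_quasidense_FPV:
  fixes G :: "'a::real_normed_vector graph"
  assumes closed: "mm_closed G" and mono: "mm_monotone G" and qd: "mm_quasidense G"
  shows "mm_type_FPV G"
  unfolding mm_type_FPV_def
proof (intro allI impI, elim conjE)
  fix U w w'
  assume U: "open U" "convex U" and meet: "U \<inter> mm_dom G \<noteq> {}" and w: "w \<in> U"
    and "\<forall>(s, s') \<in> G. s \<in> U \<longrightarrow> blinfun_apply (s' - w') (s - w) \<ge> 0"
  then have loc: "\<And>s s'. (s, s') \<in> G \<Longrightarrow> s \<in> U \<Longrightarrow> blinfun_apply (s' - w') (s - w) \<ge> 0" by auto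
  have ne: "G \<noteq> {}" using meet by (auto simp: mm_dom_def)
  have "w \<in> closure (mm_dom G)"
    using meet closure_domain_segment[OF mono qd loc U w] by blast
  moreover obtain \<rho> where \<rho>: "\<rho> > 0" "ball w \<rho> \<subseteq> U" using U w by (meson openE)
  ultimately obtain y y' where yG: "(y, y') \<in> G" and y: "norm (y - w) < \<rho>"
    unfolding closure_approachable mm_dom_def dist_norm by fastforce
  \<comment> \<open>Here \<open>l\<close> stays fixed and the tolerance \<open>d\<close>
    shrinks.\<close>
  obtain l where l: "l > 0" and stay: "\<And>s s'. (s, s') \<in> G \<Longrightarrow>
    l / 2 * (norm (s - w))\<^sup>2 + (norm (s' - w'))\<^sup>2 / (2 * l) + blinfun_apply (s' - w') (s - w) < 1 \<Longrightarrow>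
    norm (s - w) < \<rho>"
    using scaled_solution_near_domain[OF mono yG y] by (metis order_refl)
  have "(w, w') \<in> closure G"
    unfolding closure_approachable
  proof (intro allI impI)
    fix e :: real assume e: "0 < e"
    \<comment> \<open>The bound 1 makes \<open>stay\<close> applicable; the other two turn the
      weighted squares into distances below \<open>e / 2\<close>.\<close>
    define d where "d = min 1 (min (l / 2) (1 / (2 * l)) * (e / 2)\<^sup>2)"
    have d: "d > 0" "d \<le> 1" "d \<le> l / 2 * (e / 2)\<^sup>2" "d \<le> 1 / (2 * l) * (e / 2)\<^sup>2"
    proof -
      have "min (l / 2) (1 / (2 * l)) * (e / 2)\<^sup>2 \<le> l / 2 * (e / 2)\<^sup>2"
        "min (l / 2) (1 / (2 * l)) * (e / 2)\<^sup>2 \<le> 1 / (2 * l) * (e / 2)\<^sup>2"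
        by (intro mult_right_mono; simp)+
      then show "d \<le> l / 2 * (e / 2)\<^sup>2" "d \<le> 1 / (2 * l) * (e / 2)\<^sup>2" by (auto simp: d_def)
    qed (use l e in \<open>auto simp: d_def\<close>)
    obtain s s' where sG: "(s, s') \<in> G" and s:
      "l / 2 * (norm (s - w))\<^sup>2 + (norm (s' - w'))\<^sup>2 / (2 * l) + blinfun_apply (s' - w') (s - w) < d"
      using quasidense_scaled[OF ne mono qd l d(1)] by blast
    have "norm (s - w) < \<rho>" using stay[OF sG] s d by linarith
    then have "s \<in> U" using \<rho> by (auto simp: dist_norm norm_minus_commute)
    then have *: "l / 2 * (norm (s - w))\<^sup>2 + (norm (s' - w'))\<^sup>2 / (2 * l) < d"
      using loc[OF sG] s by simp
    have "0 \<le> l / 2 * (norm (s - w))\<^sup>2" "0 \<le> (norm (s' - w'))\<^sup>2 / (2 * l)" using l by auto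
    with * d have "l / 2 * (norm (s - w))\<^sup>2 < l / 2 * (e / 2)\<^sup>2"
      "1 / (2 * l) * (norm (s' - w'))\<^sup>2 < 1 / (2 * l) * (e / 2)\<^sup>2" by auto
    then have "(norm (s - w))\<^sup>2 < (e / 2)\<^sup>2" "(norm (s' - w'))\<^sup>2 < (e / 2)\<^sup>2"
      using l mult_less_cancel_left_pos[of "l / 2"] mult_less_cancel_left_pos[of "1 / (2 * l)"] by auto
    then have "norm (s - w) < e / 2" "norm (s' - w') < e / 2"
      using e power2_less_imp_less[of _ "e / 2"] by force+
    then have "dist (s, s') (w, w') < e"
      using norm_Pair_le[of "s - w" "s' - w'"] by (simp add: dist_norm)
    then show "\<exists>p\<in>G. dist p (w, w') < e" using sG by blast
  qed
  then show "(w, w') \<in> G" using closed by (simp add: mm_closed_def)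
qed

section \<open>Maximality\<close>

text \<open>With the whole space as \<open>U\<close>, type (FPV) puts into \<open>G\<close> every
  point monotonically related to all of \<open>G\<close>.\<close>

lemma FPV_imp_maximal_monotone:
  assumes "mm_monotone G" "mm_type_FPV G" "G \<noteq> {}"
  shows "mm_maximal_monotone G"
  unfolding mm_maximal_monotone_def
proof (intro conjI allI impI assms(1), elim conjE)
  fix T assume T: "mm_monotone T" "G \<subseteq> T"
  have "(w, w') \<in> G" if "(w, w') \<in> T" for w w'
  proof -
    have "\<forall>(s, s') \<in> G. s \<in> UNIV \<longrightarrow> blinfun_apply (s' - w') (s - w) \<ge> 0"
      using mm_monotoneD[OF T(1) _ that] T(2) by blast
    moreover have "UNIV \<inter> mm_dom G \<noteq> {}" using assms(3) by (simp add: mm_dom_def)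
    ultimately show ?thesis
      using assms(2)[unfolded mm_type_FPV_def, rule_format, of UNIV w w'] by simp
  qed
  then show "T = G" using T by auto
qed

theorem theorem5p2:
  fixes G :: "'a::banach graph"
  assumes "\<exists>x::'a. x \<noteq> 0"
    and "G \<noteq> {}"
    and "mm_closed G"
    and "mm_monotone G"
    and "mm_quasidense G"
  shows "mm_maximal_monotone G \<and> mm_type_FPV G"
proof
  show "mm_type_FPV G" by (rule closed_monotone_quasidense_FPV[OF assms(3-5)])
  then show "mm_maximal_monotone G" by (rule FPV_imp_maximal_monotone[OF assms(4) _ assms(2)])
qed

end
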